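(* Let $R$ be a ring and let $M_R$ be a nonsingular uniform $R$-module. Then $M_R$ is not mono-coretractable.
   Context: Rings are associative and modules are unitary right modules. A module $M$ is called mono-coretractable if for each submodule $N$ of $M$ there exists a monomorphism $M/N\to M$.
   Formalization: The module M is additionally assumed not to be simple; without this the claim is false, since every simple module is mono-coretractable and a field as a module over itself is simple, nonsingular and uniform. *)

theory Defs
  imports "HOL-Algebra.Module" "HOL-Algebra.AbelCoset"
begin

text \<open>The library's locale \<open>module\<close> requires a commutative ring of scalars, so right modules over an
  arbitrary (associative, unital) ring are introduced here on top of the library's module record.
  Throughout, \<open>a \<odot> x\<close> stands for the right action \<open>x a\<close>; this is why \<open>(a \<otimes> b) \<odot> x\<close> is
  \<open>b \<odot> (a \<odot> x)\<close>. As usual in the library, the fields \<open>mult\<close> and \<open>one\<close> of the module record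
  carry no meaning. The library's locale \<open>submodule\<close> (a subgroup of the additive group closed
  under the action) does not depend on commutativity and is used as it is.\<close>

locale right_module = R?: ring R + M?: abelian_group M for R (structure) and M (structure) +
  assumes smult_closed [simp, intro]:
      "\<lbrakk>a \<in> carrier R; x \<in> carrier M\<rbrakk> \<Longrightarrow> a \<odot>\<^bsub>M\<^esub> x \<in> carrier M"
    and smult_l_distr:
      "\<lbrakk>a \<in> carrier R; b \<in> carrier R; x \<in> carrier M\<rbrakk> \<Longrightarrow>
      (a \<oplus> b) \<odot>\<^bsub>M\<^esub> x = a \<odot>\<^bsub>M\<^esub> x \<oplus>\<^bsub>M\<^esub> b \<odot>\<^bsub>M\<^esub> x"
    and smult_r_distr:
      "\<lbrakk>a \<in> carrier R; x \<in> carrier M; y \<in> carrier M\<rbrakk> \<Longrightarrow>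
      a \<odot>\<^bsub>M\<^esub> (x \<oplus>\<^bsub>M\<^esub> y) = a \<odot>\<^bsub>M\<^esub> x \<oplus>\<^bsub>M\<^esub> a \<odot>\<^bsub>M\<^esub> y"
    and smult_assoc:
      "\<lbrakk>a \<in> carrier R; b \<in> carrier R; x \<in> carrier M\<rbrakk> \<Longrightarrow>
      (a \<otimes> b) \<odot>\<^bsub>M\<^esub> x = b \<odot>\<^bsub>M\<^esub> (a \<odot>\<^bsub>M\<^esub> x)"
    and smult_one [simp]:
      "x \<in> carrier M \<Longrightarrow> \<one> \<odot>\<^bsub>M\<^esub> x = x"

definition regular_module :: "('a, 'm) ring_scheme \<Rightarrow> ('a, 'a) module" where
  "regular_module R =
    \<lparr>carrier = carrier R, mult = mult R, one = one R, zero = zero R, add = add R,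
     smult = (\<lambda>a x. x \<otimes>\<^bsub>R\<^esub> a)\<rparr>"

definition quotient_module :: "('a, 'b, 'm) module_scheme \<Rightarrow> 'b set \<Rightarrow> ('a, 'b set) module" where
  "quotient_module M N =
    \<lparr>carrier = a_rcosets\<^bsub>M\<^esub> N, mult = undefined, one = undefined, zero = N, add = set_add M,
     smult = (\<lambda>a C. \<Union>x\<in>C. N +>\<^bsub>M\<^esub> (a \<odot>\<^bsub>M\<^esub> x))\<rparr>"

definition right_module_hom ::
  "('a, 'r) ring_scheme \<Rightarrow> ('a, 'b, 'm) module_scheme \<Rightarrow> ('a, 'c, 'n) module_scheme \<Rightarrow> ('b \<Rightarrow> 'c) set"
  where
  "right_module_hom R M M' =
    {h. h \<in> carrier M \<rightarrow> carrier M' \<and>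
        (\<forall>x\<in>carrier M. \<forall>y\<in>carrier M. h (x \<oplus>\<^bsub>M\<^esub> y) = h x \<oplus>\<^bsub>M'\<^esub> h y) \<and>
        (\<forall>a\<in>carrier R. \<forall>x\<in>carrier M. h (a \<odot>\<^bsub>M\<^esub> x) = a \<odot>\<^bsub>M'\<^esub> h x)}"

definition mono_coretractable :: "('a, 'r) ring_scheme \<Rightarrow> ('a, 'b, 'm) module_scheme \<Rightarrow> bool" where
  "mono_coretractable R M \<longleftrightarrow>
    (\<forall>N. submodule N R M \<longrightarrow>
      (\<exists>h \<in> right_module_hom R (quotient_module M N) M.
          inj_on h (carrier (quotient_module M N))))"

definition essential_submodule ::
  "('a, 'r) ring_scheme \<Rightarrow> ('a, 'b, 'm) module_scheme \<Rightarrow> 'b set \<Rightarrow> bool" where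
  "essential_submodule R M N \<longleftrightarrow>
    submodule N R M \<and>
    (\<forall>K. submodule K R M \<longrightarrow> K \<noteq> {\<zero>\<^bsub>M\<^esub>} \<longrightarrow> N \<inter> K \<noteq> {\<zero>\<^bsub>M\<^esub>})"

definition annihilator :: "('a, 'r) ring_scheme \<Rightarrow> ('a, 'b, 'm) module_scheme \<Rightarrow> 'b \<Rightarrow> 'a set" where
  "annihilator R M x = {a \<in> carrier R. a \<odot>\<^bsub>M\<^esub> x = \<zero>\<^bsub>M\<^esub>}"

text \<open>Right ideals of \<open>R\<close> are the submodules of \<open>regular_module R\<close>.\<close>

definition singular_submodule ::
  "('a, 'r) ring_scheme \<Rightarrow> ('a, 'b, 'm) module_scheme \<Rightarrow> 'b set" where
  "singular_submodule R M =
    {x \<in> carrier M. essential_submodule R (regular_module R) (annihilator R M x)}"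

definition nonsingular_module ::
  "('a, 'r) ring_scheme \<Rightarrow> ('a, 'b, 'm) module_scheme \<Rightarrow> bool" where
  "nonsingular_module R M \<longleftrightarrow> singular_submodule R M = {\<zero>\<^bsub>M\<^esub>}"

definition uniform_module :: "('a, 'r) ring_scheme \<Rightarrow> ('a, 'b, 'm) module_scheme \<Rightarrow> bool" where
  "uniform_module R M \<longleftrightarrow>
    carrier M \<noteq> {\<zero>\<^bsub>M\<^esub>} \<and>
    (\<forall>N K. submodule N R M \<longrightarrow> submodule K R M \<longrightarrow> N \<noteq> {\<zero>\<^bsub>M\<^esub>} \<longrightarrow> K \<noteq> {\<zero>\<^bsub>M\<^esub>} \<longrightarrow>
      N \<inter> K \<noteq> {\<zero>\<^bsub>M\<^esub>})"

definition simple_module :: "('a, 'r) ring_scheme \<Rightarrow> ('a, 'b, 'm) module_scheme \<Rightarrow> bool" where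
  "simple_module R M \<longleftrightarrow>
    carrier M \<noteq> {\<zero>\<^bsub>M\<^esub>} \<and>
    (\<forall>N. submodule N R M \<longrightarrow> N = {\<zero>\<^bsub>M\<^esub>} \<or> N = carrier M)"

text \<open>Simple modules must be excluded from the claim that nonsingular uniform modules are not
  mono-coretractable: the only quotients of a simple module are zero and the module itself, so it
  is always mono-coretractable, and a simple module can be nonsingular and uniform. The lemma
  \<open>regular_field_counterexample\<close> below gives a field as a module over itself.\<close>

lemma simple_module_regular_field:
  assumes "field F"
  shows "simple_module F (regular_module F)"
proof -
  interpret field F by fact
  have "N = carrier F" if N: "submodule N F (regular_module F)" "N \<noteq> {\<zero>\<^bsub>F\<^esub>}" for N
  proof -
    interpret N: submodule N F "regular_module F" by fact
    have sub: "N \<subseteq> carrier F" using N.subset by (simp add: regular_module_def)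
    have "\<zero>\<^bsub>F\<^esub> \<in> N" using N.one_closed by (simp add: regular_module_def)
    then obtain x where x: "x \<in> N" "x \<noteq> \<zero>\<^bsub>F\<^esub>" using N(2) by auto
    have "y \<in> N" if y: "y \<in> carrier F" for y
    proof -
      have u: "x \<in> Units F" using x sub by (auto simp: field_Units)
      have "(inv\<^bsub>F\<^esub> x \<otimes>\<^bsub>F\<^esub> y) \<odot>\<^bsub>regular_module F\<^esub> x \<in> N"
        using x y u by (intro N.smult_closed) auto
      moreover have "x \<otimes>\<^bsub>F\<^esub> (inv\<^bsub>F\<^esub> x \<otimes>\<^bsub>F\<^esub> y) = y"
        using u y m_assoc[OF Units_closed[OF u] Units_inv_closed[OF u] y, symmetric]
        by (simp only: Units_r_inv l_one)
      ultimately show ?thesis by (simp add: regular_module_def)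
    qed
    then show ?thesis using sub by auto
  qed
  moreover have "carrier F \<noteq> {\<zero>\<^bsub>F\<^esub>}"
    using one_not_zero by blast
  moreover have "carrier (regular_module F) = carrier F" "\<zero>\<^bsub>regular_module F\<^esub> = \<zero>\<^bsub>F\<^esub>"
    by (simp_all add: regular_module_def)
  ultimately show ?thesis
    unfolding simple_module_def by metis
qed

lemma right_module_regular_field:
  assumes "field F"
  shows "right_module F (regular_module F)"
proof -
  interpret field F by fact
  have "abelian_group (regular_module F)"
    by (rule abelian_groupI)
       (auto simp: regular_module_def a_ac intro: bexI[of _ "\<ominus>\<^bsub>F\<^esub> _"] l_neg)
  then show ?thesis
    by (intro right_module.intro right_module_axioms.intro)
       (auto simp: regular_module_def l_distr r_distr m_ac intro: ring_axioms)
qed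

lemma uniform_module_regular_field:
  assumes "field F"
  shows "uniform_module F (regular_module F)"
  using simple_module_regular_field[OF assms]
  unfolding simple_module_def uniform_module_def by blast

lemma nonsingular_module_regular_field:
  assumes "field F"
  shows "nonsingular_module F (regular_module F)"
proof -
  interpret field F by fact
  interpret M: right_module F "regular_module F" by (rule right_module_regular_field) fact
  have sub: "submodule (carrier F) F (regular_module F)"
    using M.add.subgroup_self
    by (intro submodule.intro submodule_axioms.intro) (auto simp: regular_module_def)
  have eq: "x = \<zero>\<^bsub>F\<^esub>" if "x \<in> singular_submodule F (regular_module F)" for x
  proof (rule ccontr)
    assume "x \<noteq> \<zero>\<^bsub>F\<^esub>"
    then have "annihilator F (regular_module F) x = {\<zero>\<^bsub>F\<^esub>}"
      using that by (auto simp: annihilator_def regular_module_def singular_submodule_def integral_iff)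
    moreover have "carrier F \<noteq> {\<zero>\<^bsub>F\<^esub>}"
      using one_not_zero by blast
    ultimately show False
      using that sub
      by (auto simp: singular_submodule_def essential_submodule_def regular_module_def)
  qed
  have K: "K \<subseteq> carrier F" if "submodule K F (regular_module F)" for K
    using submodule.axioms(1)[OF that, THEN subgroup.subset] by (simp add: regular_module_def)
  have zero: "\<zero>\<^bsub>F\<^esub> \<in> carrier (regular_module F)"
    by (simp add: regular_module_def)
  have "annihilator F (regular_module F) \<zero>\<^bsub>F\<^esub> = carrier F"
    by (auto simp: annihilator_def regular_module_def)
  then have "\<zero>\<^bsub>F\<^esub> \<in> singular_submodule F (regular_module F)"
    using sub K zero by (simp add: singular_submodule_def essential_submodule_def Int_absorb1)
  with eq have "singular_submodule F (regular_module F) = {\<zero>\<^bsub>F\<^esub>}"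
    by blast
  then show ?thesis
    by (simp add: nonsingular_module_def regular_module_def)
qed

lemma simple_module_imp_mono_coretractable:
  assumes "right_module R M" "simple_module R M"
  shows "mono_coretractable R M"
  unfolding mono_coretractable_def
proof (intro allI impI)
  interpret right_module R M by fact
  fix N assume N: "submodule N R M"
  show "\<exists>h \<in> right_module_hom R (quotient_module M N) M. inj_on h (carrier (quotient_module M N))"
  proof (cases "N = {\<zero>\<^bsub>M\<^esub>}")
    case True
    have "carrier (quotient_module M N) = (\<lambda>x. {x}) ` carrier M"
      by (auto simp: True quotient_module_def A_RCOSETS_defs r_coset_def)
    moreover have "the_elem \<in> right_module_hom R (quotient_module M N) M"
      by (auto simp: True right_module_hom_def quotient_module_def A_RCOSETS_defs a_r_coset_def
          r_coset_def set_add_defs)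
    ultimately show ?thesis
      by (intro bexI[of _ the_elem]) (auto simp: inj_on_def)
  next
    case False
    then have N': "N = carrier M"
      using N assms(2) by (auto simp: simple_module_def)
    have "carrier M +>\<^bsub>M\<^esub> x = carrier M" if "x \<in> carrier M" for x
      using that M.add.coset_join2[OF that M.add.subgroup_self]
      by (simp add: a_r_coset_def)
    then have "carrier (quotient_module M N) = {carrier M}"
      by (auto simp: N' quotient_module_def A_RCOSETS_def RCOSETS_def a_r_coset_def
          simp flip: a_r_coset_def)
    moreover have "a \<odot>\<^bsub>M\<^esub> \<zero>\<^bsub>M\<^esub> = \<zero>\<^bsub>M\<^esub>" if "a \<in> carrier R" for a
      using smult_r_distr[OF that, of "\<zero>\<^bsub>M\<^esub>" "\<zero>\<^bsub>M\<^esub>"] that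
      by (simp add: M.add.l_cancel_one')
    ultimately show ?thesis
      by (intro bexI[of _ "\<lambda>_. \<zero>\<^bsub>M\<^esub>"]) (auto simp: right_module_hom_def)
  qed
qed

lemma regular_field_counterexample:
  assumes "field F"
  shows "right_module F (regular_module F) \<and> nonsingular_module F (regular_module F) \<and>
    uniform_module F (regular_module F) \<and> mono_coretractable F (regular_module F)"
  using assms
  by (simp add: right_module_regular_field nonsingular_module_regular_field
      uniform_module_regular_field simple_module_regular_field simple_module_imp_mono_coretractable)

end

theory Submission
  imports Defs
begin

text \<open>Let \<open>N\<close> be a proper nonzero submodule of \<open>M\<close> and \<open>x \<notin> N\<close>. In a uniform module the right
  ideal \<open>{a. x a \<in> N}\<close> is essential: a nonzero right ideal \<open>K\<close> either kills \<open>x\<close> or yields a nonzero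
  submodule \<open>x K\<close>, which meets \<open>N\<close>. A monomorphism \<open>h : M/N \<rightarrow> M\<close> sends the coset of \<open>x\<close> to
  a nonzero element killed by this right ideal, so \<open>M\<close> has a nonzero singular element.\<close>

context right_module
begin

lemma smult_r_null [simp]:
  assumes "a \<in> carrier R"
  shows "a \<odot>\<^bsub>M\<^esub> \<zero>\<^bsub>M\<^esub> = \<zero>\<^bsub>M\<^esub>"
  using smult_r_distr[OF assms, of "\<zero>\<^bsub>M\<^esub>" "\<zero>\<^bsub>M\<^esub>"] assms by (simp add: M.add.l_cancel_one')

lemma smult_l_null [simp]:
  assumes "x \<in> carrier M"
  shows "\<zero> \<odot>\<^bsub>M\<^esub> x = \<zero>\<^bsub>M\<^esub>"
  using smult_l_distr[of \<zero> \<zero> x] assms by (simp add: M.add.l_cancel_one')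

lemma smult_l_minus:
  assumes "a \<in> carrier R" "x \<in> carrier M"
  shows "(\<ominus> a) \<odot>\<^bsub>M\<^esub> x = \<ominus>\<^bsub>M\<^esub> (a \<odot>\<^bsub>M\<^esub> x)"
  using smult_l_distr[of "\<ominus> a" a x] assms
  by (simp add: R.l_neg M.minus_equality)

text \<open>This lemma and \<open>right_idealD\<close> translate between submodules of
  \<open>regular_module R\<close> and closure conditions in \<open>R\<close>. The action of b there
  is right multiplication by b, hence the condition on \<open>a \<otimes> b\<close>.\<close>

lemma right_idealI:
  assumes "K \<subseteq> carrier R" "\<zero> \<in> K"
    and "\<And>a b. \<lbrakk>a \<in> K; b \<in> K\<rbrakk> \<Longrightarrow> a \<oplus> b \<in> K"
    and "\<And>a. a \<in> K \<Longrightarrow> \<ominus> a \<in> K"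
    and "\<And>a b. \<lbrakk>a \<in> K; b \<in> carrier R\<rbrakk> \<Longrightarrow> a \<otimes> b \<in> K"
  shows "submodule K R (regular_module R)"
proof (intro submodule.intro submodule_axioms.intro)
  have "subgroup K (add_monoid R)"
    using assms by (intro subgroup.intro) (auto simp: a_inv_def)
  \<comment> \<open>The two additive monoids agree in carrier, operation and unit, but their record
    extensions have different types. Unfolding \<open>subgroup\<close> and \<open>m_inv\<close>
    leaves only the common fields.\<close>
  then show "subgroup K (add_monoid (regular_module R))"
    by (simp add: regular_module_def subgroup_def m_inv_def)
qed (use assms in \<open>auto simp: regular_module_def\<close>)

lemma right_idealD:
  assumes "submodule K R (regular_module R)"
  shows "K \<subseteq> carrier R" "\<zero> \<in> K"
    and "\<lbrakk>a \<in> K; b \<in> K\<rbrakk> \<Longrightarrow> a \<oplus> b \<in> K"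
    and "a \<in> K \<Longrightarrow> \<ominus> a \<in> K"
    and "\<lbrakk>a \<in> K; b \<in> carrier R\<rbrakk> \<Longrightarrow> a \<otimes> b \<in> K"
proof -
  interpret K: submodule K R "regular_module R" by fact
  have sg: "subgroup K (add_monoid R)"
    using K.subgroup_axioms by (simp add: regular_module_def subgroup_def m_inv_def)
  show "K \<subseteq> carrier R" "\<zero> \<in> K" "\<lbrakk>a \<in> K; b \<in> K\<rbrakk> \<Longrightarrow> a \<oplus> b \<in> K" "a \<in> K \<Longrightarrow> \<ominus> a \<in> K"
    using subgroup.subset[OF sg] subgroup.one_closed[OF sg] subgroup.m_closed[OF sg, of a b]
      subgroup.m_inv_closed[OF sg, of a] by (auto simp: a_inv_def)
  show "\<lbrakk>a \<in> K; b \<in> carrier R\<rbrakk> \<Longrightarrow> a \<otimes> b \<in> K"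
    using K.smult_closed[of b a] by (simp add: regular_module_def)
qed

text \<open>The annihilator is the kernel of the linear map a \<mapsto> x a from R to M.\<close>

lemma annihilator_right_ideal:
  assumes "x \<in> carrier M"
  shows "submodule (annihilator R M x) R (regular_module R)"
  by (rule right_idealI)
     (use assms in \<open>auto simp: annihilator_def smult_l_distr smult_l_minus smult_assoc\<close>)

text \<open>This is the image of K under the linear map a \<mapsto> x a. Each closure property is a
  module law read from right to left.\<close>

lemma smult_right_ideal_submodule:
  assumes "submodule K R (regular_module R)" "x \<in> carrier M"
  shows "submodule ((\<lambda>a. a \<odot>\<^bsub>M\<^esub> x) ` K) R M"
proof (intro submodule.intro submodule_axioms.intro)
  note K = right_idealD[OF assms(1)]
  have inK: "a \<in> carrier R" if "a \<in> K" for a using K(1) that by blast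
  show "subgroup ((\<lambda>a. a \<odot>\<^bsub>M\<^esub> x) ` K) (add_monoid M)"
  proof (rule M.add.subgroupI)
    show "(\<lambda>a. a \<odot>\<^bsub>M\<^esub> x) ` K \<subseteq> carrier M" using inK assms(2) by auto
    show "(\<lambda>a. a \<odot>\<^bsub>M\<^esub> x) ` K \<noteq> {}" using K(2) by auto
  next
    fix y assume "y \<in> (\<lambda>a. a \<odot>\<^bsub>M\<^esub> x) ` K"
    then show "\<ominus>\<^bsub>M\<^esub> y \<in> (\<lambda>a. a \<odot>\<^bsub>M\<^esub> x) ` K"
      using inK K(4) assms(2) by (auto simp flip: smult_l_minus)
  next
    fix y z assume "y \<in> (\<lambda>a. a \<odot>\<^bsub>M\<^esub> x) ` K" "z \<in> (\<lambda>a. a \<odot>\<^bsub>M\<^esub> x) ` K"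
    then show "y \<oplus>\<^bsub>M\<^esub> z \<in> (\<lambda>a. a \<odot>\<^bsub>M\<^esub> x) ` K"
      using inK K(3) assms(2) by (auto simp flip: smult_l_distr)
  qed
  show "b \<odot>\<^bsub>M\<^esub> y \<in> (\<lambda>a. a \<odot>\<^bsub>M\<^esub> x) ` K"
    if "b \<in> carrier R" "y \<in> (\<lambda>a. a \<odot>\<^bsub>M\<^esub> x) ` K" for b y
    using that inK K(5) assms(2) by (auto simp flip: smult_assoc)
qed

text \<open>The action on the quotient is a union over all representatives. Representatives differ
  by elements of N, which the action keeps in N, so all members of the union coincide.\<close>

lemma quotient_smult_coset:
  assumes "submodule N R M" "a \<in> carrier R" "x \<in> carrier M"
  shows "a \<odot>\<^bsub>quotient_module M N\<^esub> (N +>\<^bsub>M\<^esub> x) = N +>\<^bsub>M\<^esub> (a \<odot>\<^bsub>M\<^esub> x)"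
proof -
  interpret N: submodule N R M by fact
  have N: "n \<in> carrier M" if "n \<in> N" for n using N.subset that by auto
  have "N +>\<^bsub>M\<^esub> (a \<odot>\<^bsub>M\<^esub> y) = N +>\<^bsub>M\<^esub> (a \<odot>\<^bsub>M\<^esub> x)" if y: "y \<in> N +>\<^bsub>M\<^esub> x" for y
  proof -
    obtain n where n: "n \<in> N" "y = n \<oplus>\<^bsub>M\<^esub> x"
      using y by (auto simp: a_r_coset_def')
    then have "a \<odot>\<^bsub>M\<^esub> y \<in> N +>\<^bsub>M\<^esub> (a \<odot>\<^bsub>M\<^esub> x)"
      using assms N N.smult_closed by (auto simp: smult_r_distr a_r_coset_def')
    from M.a_repr_independence[OF this _ N.subgroup_axioms] show ?thesis
      using assms(2,3) by (metis smult_closed)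
  qed
  \<comment> \<open>The union ranges over a nonempty set, so it equals the common coset rather than
    the empty set.\<close>
  moreover have "x \<in> N +>\<^bsub>M\<^esub> x"
    using M.add.rcos_self[OF assms(3) N.subgroup_axioms] by (simp add: a_r_coset_def)
  ultimately show ?thesis
    unfolding quotient_module_def module.simps by blast
qed

lemma coset_in_quotient:
  assumes "x \<in> carrier M"
  shows "N +>\<^bsub>M\<^esub> x \<in> carrier (quotient_module M N)"
  using assms by (auto simp: quotient_module_def A_RCOSETS_def RCOSETS_def a_r_coset_def)

text \<open>Since N is its own multiple by the scalar \<open>\<zero>\<close>, homogeneity of h
  suffices; this avoids establishing the group structure of the quotient.\<close>

lemma quotient_hom_zero:
  assumes N: "submodule N R M" and h: "h \<in> right_module_hom R (quotient_module M N) M"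
  shows "h N = \<zero>\<^bsub>M\<^esub>"
proof -
  interpret N: submodule N R M by fact
  have C: "N +>\<^bsub>M\<^esub> \<zero>\<^bsub>M\<^esub> = N"
    using M.a_coset_add_zero N.subset by simp
  then have N_in: "N \<in> carrier (quotient_module M N)"
    using coset_in_quotient[of "\<zero>\<^bsub>M\<^esub>" N] by simp
  have "\<zero> \<odot>\<^bsub>quotient_module M N\<^esub> N = N"
    using quotient_smult_coset[OF N, of \<zero> "\<zero>\<^bsub>M\<^esub>"] C by simp
  moreover have "h (\<zero> \<odot>\<^bsub>quotient_module M N\<^esub> N) = \<zero> \<odot>\<^bsub>M\<^esub> h N" "h N \<in> carrier M"
    using h N_in by (auto simp: right_module_hom_def)
  ultimately show ?thesis by simp
qed

text \<open>The coset of x a is N, the zero of the quotient, and h commutes with the action of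
  a.\<close>

lemma quotient_hom_annihilates:
  assumes N: "submodule N R M" and h: "h \<in> right_module_hom R (quotient_module M N) M"
    and a: "a \<in> carrier R" and x: "x \<in> carrier M" and ax: "a \<odot>\<^bsub>M\<^esub> x \<in> N"
  shows "a \<odot>\<^bsub>M\<^esub> h (N +>\<^bsub>M\<^esub> x) = \<zero>\<^bsub>M\<^esub>"
proof -
  interpret N: submodule N R M by fact
  have "N +>\<^bsub>M\<^esub> (a \<odot>\<^bsub>M\<^esub> x) = N"
    using a x M.a_coset_join2[OF _ N.subgroup_axioms ax] by simp
  then have "a \<odot>\<^bsub>quotient_module M N\<^esub> (N +>\<^bsub>M\<^esub> x) = N"
    using quotient_smult_coset[OF N a x] by simp
  moreover have "h (a \<odot>\<^bsub>quotient_module M N\<^esub> (N +>\<^bsub>M\<^esub> x)) = a \<odot>\<^bsub>M\<^esub> h (N +>\<^bsub>M\<^esub> x)"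
    using h a coset_in_quotient[OF x] by (simp add: right_module_hom_def)
  ultimately show ?thesis
    using quotient_hom_zero[OF N h] by simp
qed

text \<open>This is the essentiality of the right ideal of all a with x a in N, put in terms of
  elements so that this ideal itself need not be shown to be a submodule.\<close>

lemma uniform_meets_right_ideal:
  assumes "uniform_module R M" "submodule N R M" "N \<noteq> {\<zero>\<^bsub>M\<^esub>}" "x \<in> carrier M"
    and K: "submodule K R (regular_module R)" "K \<noteq> {\<zero>}"
  obtains a where "a \<in> K" "a \<noteq> \<zero>" "a \<odot>\<^bsub>M\<^esub> x \<in> N"
proof -
  interpret N: submodule N R M by fact
  have zero: "\<zero>\<^bsub>M\<^esub> \<in> N" using N.one_closed by simp
  note K' = right_idealD[OF K(1)]
  let ?xK = "(\<lambda>a. a \<odot>\<^bsub>M\<^esub> x) ` K"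
  have sub: "submodule ?xK R M"
    using smult_right_ideal_submodule[OF K(1) assms(4)] .
  show ?thesis
  proof (cases "?xK = {\<zero>\<^bsub>M\<^esub>}")
    case True
    obtain a where "a \<in> K" "a \<noteq> \<zero>" using K(2) K'(2) by blast
    moreover from this have "a \<odot>\<^bsub>M\<^esub> x \<in> ?xK" by blast
    then have "a \<odot>\<^bsub>M\<^esub> x \<in> N" unfolding True using zero by simp
    ultimately show ?thesis using that by blast
  next
    case False
    then have "N \<inter> ?xK \<noteq> {\<zero>\<^bsub>M\<^esub>}"
      using assms(1-3) sub by (auto simp: uniform_module_def)
    \<comment> \<open>Differing from the zero submodule yields a nonzero element only once the
      intersection is known to contain zero.\<close>
    moreover have "\<zero>\<^bsub>M\<^esub> \<in> N \<inter> ?xK"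
      using zero subgroup.one_closed[OF submodule.axioms(1)[OF sub]] by simp
    ultimately obtain a where "a \<in> K" "a \<odot>\<^bsub>M\<^esub> x \<in> N" "a \<odot>\<^bsub>M\<^esub> x \<noteq> \<zero>\<^bsub>M\<^esub>" by blast
    moreover from this have "a \<noteq> \<zero>" using assms(4) by auto
    ultimately show ?thesis using that by blast
  qed
qed

end

theorem proposition3p3:
  fixes R :: "('a, 'r) ring_scheme" and M :: "('a, 'b, 'm) module_scheme"
  assumes "right_module R M"
    and "nonsingular_module R M"
    and "uniform_module R M"
    and "\<not> simple_module R M"
  shows "\<not> mono_coretractable R M"
proof
  interpret right_module R M by fact
  assume "mono_coretractable R M"
  \<comment> \<open>A uniform module is nonzero by definition, so simplicity can fail only through a
    proper nonzero submodule.\<close>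
  moreover obtain N where N: "submodule N R M" "N \<noteq> {\<zero>\<^bsub>M\<^esub>}" "N \<noteq> carrier M"
    using assms(3,4) by (auto simp: simple_module_def uniform_module_def)
  ultimately obtain h where h: "h \<in> right_module_hom R (quotient_module M N) M"
    and inj: "inj_on h (carrier (quotient_module M N))"
    by (auto simp: mono_coretractable_def)
  interpret N: submodule N R M by fact
  obtain x where x: "x \<in> carrier M" "x \<notin> N"
    using N(3) N.subset by auto
  let ?C = "N +>\<^bsub>M\<^esub> x"
  have "x \<in> ?C"
    using M.add.rcos_self[OF x(1) N.subgroup_axioms] by (simp add: a_r_coset_def)
  then have "?C \<noteq> N" using x(2) by blast
  \<comment> \<open>Injectivity compares only members of the carrier, so N has to be recognised as a
    coset.\<close>
  moreover have "N +>\<^bsub>M\<^esub> \<zero>\<^bsub>M\<^esub> = N"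
    using M.a_coset_add_zero N.subset by simp
  then have "N \<in> carrier (quotient_module M N)"
    using coset_in_quotient[of "\<zero>\<^bsub>M\<^esub>" N] by simp
  ultimately have "h ?C \<noteq> h N"
    using inj_onD[OF inj] coset_in_quotient[OF x(1)] by blast
  moreover have "h N = \<zero>\<^bsub>M\<^esub>"
    using quotient_hom_zero[OF N(1) h] .
  moreover have hC: "h ?C \<in> carrier M"
    using h coset_in_quotient[OF x(1)] by (auto simp: right_module_hom_def)
  \<comment> \<open>Every a with x a in N kills \<open>h ?C\<close>, so the annihilator inherits
    essentiality from the right ideal of these a.\<close>
  have "annihilator R M (h ?C) \<inter> K \<noteq> {\<zero>\<^bsub>R\<^esub>}"
    if K: "submodule K R (regular_module R)" "K \<noteq> {\<zero>\<^bsub>R\<^esub>}" for K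
  proof -
    obtain a where a: "a \<in> K" "a \<noteq> \<zero>\<^bsub>R\<^esub>" "a \<odot>\<^bsub>M\<^esub> x \<in> N"
      using uniform_meets_right_ideal[OF assms(3) N(1,2) x(1) K] .
    moreover have "a \<in> carrier R" using a(1) right_idealD(1)[OF K(1)] by blast
    ultimately have "a \<in> annihilator R M (h ?C)"
      using quotient_hom_annihilates[OF N(1) h _ x(1)] by (simp add: annihilator_def)
    then show ?thesis using a by blast
  qed
  then have "h ?C \<in> singular_submodule R M"
    using annihilator_right_ideal[OF hC] hC
    by (simp add: singular_submodule_def essential_submodule_def regular_module_def)
  ultimately show False
    using assms(2) by (simp add: nonsingular_module_def)
qed

end
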